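(* For every metric space $X$ the following equality holds: $$\mathrm{AN\text{-}asdim}\,X=\sup\{\ell\text{-}\mathrm{asdim}_{\omega}X : \omega\in\mathbb N^*\}.$$
   Context: $\mathbb N^*=\beta\mathbb N\setminus\mathbb N$ is the set of non-principal ultrafilters on $\mathbb N$. Let $(X,d)$ be a metric space. For subsets $U,V\subset X$ put $d(U,V)=\inf\{d(u,v)\mid u\in U, v\in V\}$. A family of subsets of $X$ is $\lambda$-disjoint if $d(U,V)>\lambda$ for any two distinct members $U,V$; it is $D$-uniformly bounded if $\mathrm{diam}(U)\le D$ for every member $U$. For an integer $n\ge 0$, write $(\lambda,D)\text{-}\dim X\le n$ if there are $n+1$ families $\mathcal U^0,\dots,\mathcal U^n$ of subsets of $X$, each $\lambda$-disjoint and $D$-uniformly bounded, such that $\mathcal U^0\cup\dots\cup\mathcal U^n$ covers $X$; $(\lambda,D)\text{-}\dim X$ is the smallest integer $n\ge 0$ with this property, and $\infty$ if there is none. $\mathrm{AN\text{-}asdim}\,X\le n$ (asymptotic Assouad–Nagata dimension) means: there are $c>0$ and $r_0$ such that $(\lambda,c\lambda)\text{-}\dim X\le n$ for all $\lambda>r_0$; $\mathrm{AN\text{-}asdim}\,X$ is the smallest integer $n\ge 0$ for which this holds, and $\infty$ if there is none. For a real $c>0$ let $f_c:\mathbb N\to\alpha\mathbb N=\mathbb N\cup\{\infty\}$ (the one-point compactification of the discrete space $\mathbb N=\{0,1,2,\dots\}$ of values) be $f_c(\lambda)=(\lambda,c\lambda)\text{-}\dim X$, and for $\omega\in\mathbb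 N^*$ let $\overline f_c(\omega)=\lim_\omega f_c\in\alpha\mathbb N$ be its limit along $\omega$. The asymptotic dimension with linear control with respect to $\omega$ is $\ell\text{-}\mathrm{asdim}_\omega X=\min_{c>0}\overline f_c(\omega)$. *)

theory Defs
  imports "HOL-Analysis.Analysis"
begin

text \<open>
  A filter on \<open>nat\<close> is given by its \<^const>\<open>eventually\<close> predicate: a set \<open>A\<close> belongs to \<open>F\<close>
  iff \<open>eventually (\<lambda>k. k \<in> A) F\<close>.  \<^const>\<open>bot\<close> is the improper filter, and the principal
  ultrafilter at \<open>k\<close> is \<open>principal {k}\<close>.
\<close>

definition ultrafilter :: "'a filter \<Rightarrow> bool" where
  "ultrafilter F \<longleftrightarrow> F \<noteq> bot \<and> (\<forall>P. eventually P F \<or> eventually (\<lambda>k. \<not> P k) F)"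

definition nonprincipal_ultrafilters :: "nat filter set" where
  "nonprincipal_ultrafilters = {\<omega>. ultrafilter \<omega> \<and> (\<forall>k. \<omega> \<noteq> principal {k})}"

context Metric_space
begin

text \<open>
  Distances between sets and diameters are extended reals: the infimum over an empty set of
  pairs is \<open>\<infinity>\<close>, and an unbounded set has diameter \<open>\<infinity>\<close>.  The empty set has diameter \<open>0\<close>
  (the supremum of an empty set of extended reals would be \<open>-\<infinity>\<close>).
\<close>

definition set_dist :: "'a set \<Rightarrow> 'a set \<Rightarrow> ereal" where
  "set_dist U V = (INF u\<in>U. INF v\<in>V. ereal (d u v))"

definition set_diam :: "'a set \<Rightarrow> ereal" where
  "set_diam U = (if U = {} then 0 else SUP x\<in>U. SUP y\<in>U. ereal (d x y))"

definition disjoint_family_by :: "real \<Rightarrow> 'a set set \<Rightarrow> bool" where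
  "disjoint_family_by r \<U> \<longleftrightarrow> (\<forall>U\<in>\<U>. \<forall>V\<in>\<U>. U \<noteq> V \<longrightarrow> set_dist U V > ereal r)"

definition uniformly_bounded_by :: "real \<Rightarrow> 'a set set \<Rightarrow> bool" where
  "uniformly_bounded_by D \<U> \<longleftrightarrow> (\<forall>U\<in>\<U>. set_diam U \<le> ereal D)"

definition scale_dim_le :: "real \<Rightarrow> real \<Rightarrow> nat \<Rightarrow> bool" where
  "scale_dim_le r D n \<longleftrightarrow>
     (\<exists>\<U> :: nat \<Rightarrow> 'a set set.
        (\<forall>i\<le>n. \<U> i \<subseteq> Pow M \<and> disjoint_family_by r (\<U> i) \<and> uniformly_bounded_by D (\<U> i)) \<and>
        \<Union> (\<Union>i\<le>n. \<U> i) = M)"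

text \<open>Infima in \<^typ>\<open>enat\<close> are minima of nonempty sets, and the infimum of the empty set is \<open>\<infinity>\<close>.\<close>

definition scale_dim :: "real \<Rightarrow> real \<Rightarrow> enat" where
  "scale_dim r D = Inf {enat n | n. scale_dim_le r D n}"

definition AN_asdim_le :: "nat \<Rightarrow> bool" where
  "AN_asdim_le n \<longleftrightarrow> (\<exists>c>0. \<exists>r\<^sub>0. \<forall>r>r\<^sub>0. scale_dim_le r (c * r) n)"

definition AN_asdim :: enat where
  "AN_asdim = Inf {enat n | n. AN_asdim_le n}"

definition linear_dim :: "real \<Rightarrow> nat \<Rightarrow> enat" where
  "linear_dim c k = scale_dim (real k) (c * real k)"

text \<open>
  The order topology of \<^typ>\<open>enat\<close> is that of the one-point compactification of the discrete
  space \<open>nat\<close>: the points \<open>enat n\<close> are isolated, and the neighbourhoods of \<open>\<infinity>\<close> are the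
  sets that contain \<open>\<infinity>\<close> and all but finitely many points.  It is compact and Hausdorff, so the
  limit along an ultrafilter exists and is unique.  The minimum over \<open>c\<close> is an infimum in
  \<^typ>\<open>enat\<close> and hence attained.
\<close>

definition l_asdim :: "nat filter \<Rightarrow> enat" where
  "l_asdim \<omega> = (INF c\<in>{c::real. c > 0}. Lim \<omega> (linear_dim c))"

end

end

theory Submission
  imports Defs
begin

text \<open>
  Fix a natural number \<open>n\<close>; both sides are extended naturals, so it suffices that the left side
  is at most \<open>n\<close> iff the right side is.  Because \<open>n\<close> has an immediate successor in \<^typ>\<open>enat\<close>,
  the limit of \<open>f\<^sub>c\<close> along \<open>\<omega>\<close> is at most \<open>n\<close> iff the good set
  \<open>A\<^sub>c = {k. f\<^sub>c k \<le> n}\<close> belongs to \<open>\<omega>\<close> (\<open>Lim_ultrafilter_le_enat_iff\<close>).  Hence the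
  right side is at most \<open>n\<close> iff every non-principal ultrafilter contains some \<open>A\<^sub>c\<close>, with \<open>c\<close>
  depending on the ultrafilter.

  The left side is at most \<open>n\<close> iff a single \<open>A\<^sub>c\<close> is cofinite (\<open>AN_asdim_le_iff\<close>); passing
  from integral to real scales only costs a factor \<open>2\<close> in \<open>c\<close>, by rounding the scale up.  One
  implication is then clear, since non-principal ultrafilters contain all cofinite sets.  The
  other is a compactness argument: the sets \<open>A\<^sub>c\<close> grow with \<open>c\<close>, and if none were cofinite,
  one could choose points \<open>a m\<close> outside \<open>A\<^sub>m\<close> tending to infinity.  An ultrafilter containing
  all tails of the sequence \<open>a\<close> is non-principal and contains no \<open>A\<^sub>c\<close>
  (\<open>increasing_sets_eventually_sequentially\<close>).
\<close>

section \<open>Ultrafilters\<close>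

text \<open>
  Zorn's lemma for the reversed order of filters.  The infimum of a chain of proper filters is
  proper because an event holds eventually along it only if it does so along some member.
\<close>

lemma ex_ultrafilter_le:
  fixes F :: "'a filter"
  assumes "F \<noteq> bot"
  shows "\<exists>U. ultrafilter U \<and> U \<le> F"
proof -
  define A where "A = {G. G \<noteq> bot \<and> G \<le> F}"
  have "\<exists>U\<in>A. \<forall>G\<in>A. U \<ge> G \<longrightarrow> G = U"
  proof (rule predicate_Zorn)
    show "partial_order_on A (relation_of (\<ge>) A)"
      by (rule partial_order_on_relation_ofI) auto
  next
    fix C assume "C \<in> Chains (relation_of (\<ge>) A)"
    then have CA: "C \<subseteq> A" and chain: "\<And>G H. G \<in> C \<Longrightarrow> H \<in> C \<Longrightarrow> G \<le> H \<or> H \<le> G"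
      unfolding Chains_def relation_of_def by auto
    show "\<exists>u\<in>A. \<forall>a\<in>C. a \<ge> u"
    proof (cases "C = {}")
      case True
      then show ?thesis using assms by (auto simp: A_def)
    next
      case False
      have "eventually P (Inf C) \<longleftrightarrow> (\<exists>G\<in>C. eventually P G)" for P
      proof (rule eventually_Inf_base[OF False])
        fix G H assume "G \<in> C" "H \<in> C"
        with chain[of G H] show "\<exists>x\<in>C. x \<le> inf G H" by auto
      qed
      from this[of "\<lambda>_. False"] have "Inf C \<noteq> bot"
        using CA by (auto simp: A_def trivial_limit_def)
      moreover have "Inf C \<le> F"
        using False CA by (auto simp: A_def intro: Inf_lower2)
      ultimately show ?thesis
        by (auto simp: A_def intro!: bexI[of _ "Inf C"] Inf_lower)
    qed
  qed
  then obtain U where U: "U \<noteq> bot" "U \<le> F"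
    and min: "\<And>G. G \<noteq> bot \<Longrightarrow> G \<le> F \<Longrightarrow> G \<le> U \<Longrightarrow> G = U"
    by (auto simp: A_def)
  have "eventually P U \<or> eventually (\<lambda>x. \<not> P x) U" for P
  proof (rule disjCI)
    assume "\<not> eventually (\<lambda>x. \<not> P x) U"
    then have "inf U (principal {x. P x}) \<noteq> bot"
      by (simp add: trivial_limit_def eventually_inf_principal)
    then have "inf U (principal {x. P x}) = U"
      using U(2) by (intro min) (auto intro: le_infI1)
    moreover have "eventually P (inf U (principal {x. P x}))"
      by (simp add: eventually_inf_principal)
    ultimately show "eventually P U" by simp
  qed
  with U show ?thesis by (auto simp: ultrafilter_def)
qed

lemma nonprincipal_ultrafilters_iff:
  "\<omega> \<in> nonprincipal_ultrafilters \<longleftrightarrow> ultrafilter \<omega> \<and> \<omega> \<le> sequentially"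
proof
  assume "\<omega> \<in> nonprincipal_ultrafilters"
  then have u: "ultrafilter \<omega>" and np: "\<And>k. \<omega> \<noteq> principal {k}"
    by (auto simp: nonprincipal_ultrafilters_def)
  have ne: "eventually (\<lambda>j. j \<noteq> k) \<omega>" for k
  proof (rule ccontr)
    assume "\<not> eventually (\<lambda>j. j \<noteq> k) \<omega>"
    with u have k: "eventually (\<lambda>j. j = k) \<omega>"
      by (fastforce simp: ultrafilter_def)
    have "P k" if "eventually P \<omega>" for P
    proof -
      have "eventually (\<lambda>j. P k) \<omega>"
        using that k by eventually_elim simp
      with u show ?thesis by (simp add: ultrafilter_def eventually_const_iff)
    qed
    with k have "\<omega> = principal {k}"
      by (auto simp: filter_eq_iff eventually_principal elim: eventually_mono)
    with np show False by blast
  qed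
  have "eventually (\<lambda>j. \<forall>k\<in>{..<N}. j \<noteq> k) \<omega>" for N
    using ne by (simp add: eventually_ball_finite)
  then have ge: "eventually (\<lambda>j. N \<le> j) \<omega>" for N
    by (rule eventually_mono[of "\<lambda>j. \<forall>k\<in>{..<N}. j \<noteq> k"]) (auto simp: not_less[symmetric])
  have "\<omega> \<le> sequentially"
    by (rule filter_leI) (auto simp: eventually_sequentially intro: eventually_mono[OF ge])
  with u show "ultrafilter \<omega> \<and> \<omega> \<le> sequentially" by blast
next
  assume *: "ultrafilter \<omega> \<and> \<omega> \<le> sequentially"
  have "\<omega> \<noteq> principal {k}" for k
  proof
    assume "\<omega> = principal {k}"
    with * have "eventually (\<lambda>j. k < j) (principal {k})"
      by (metis eventually_gt_at_top filter_leD)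
    then show False by (simp add: eventually_principal)
  qed
  with * show "\<omega> \<in> nonprincipal_ultrafilters"
    by (simp add: nonprincipal_ultrafilters_def)
qed

text \<open>
  The compactness argument: a choice of an index \<open>m\<close> for every non-principal ultrafilter can be
  made uniform, and even for the Frechet filter itself.
\<close>

lemma increasing_sets_eventually_sequentially:
  fixes A :: "nat \<Rightarrow> nat set"
  assumes "mono A"
    and "\<And>\<omega>. \<omega> \<in> nonprincipal_ultrafilters \<Longrightarrow> \<exists>m. eventually (\<lambda>k. k \<in> A m) \<omega>"
  shows "\<exists>m. eventually (\<lambda>k. k \<in> A m) sequentially"
proof (rule ccontr)
  assume "\<not> (\<exists>m. eventually (\<lambda>k. k \<in> A m) sequentially)"
  then have "\<forall>m. \<exists>k\<ge>m. k \<notin> A m"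
    by (auto simp: eventually_sequentially)
  then obtain a where a: "\<And>m. m \<le> a m" "\<And>m. a m \<notin> A m"
    by metis
  obtain \<omega> where \<omega>: "ultrafilter \<omega>" "\<omega> \<le> filtermap a sequentially"
    using ex_ultrafilter_le[of "filtermap a sequentially"] by (auto simp: filtermap_bot_iff)
  have "filterlim a sequentially sequentially"
    by (rule filterlim_at_top_mono[OF filterlim_ident]) (simp add: a)
  then have "filtermap a sequentially \<le> sequentially"
    by (simp add: filterlim_def)
  with \<omega> have "\<omega> \<in> nonprincipal_ultrafilters"
    by (auto simp: nonprincipal_ultrafilters_iff)
  then obtain m where m: "eventually (\<lambda>k. k \<in> A m) \<omega>"
    using assms(2) by blast
  have "a i \<notin> A m" if "i \<ge> m" for i
    using a(2)[of i] monoD[OF assms(1) that] by blast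
  then have "eventually (\<lambda>k. k \<notin> A m) (filtermap a sequentially)"
    by (auto simp: eventually_filtermap eventually_sequentially)
  then have "eventually (\<lambda>k. k \<notin> A m) \<omega>"
    using \<omega>(2) by (rule filter_leD[rotated])
  with m have "eventually (\<lambda>k. False) \<omega>"
    by eventually_elim simp
  with \<omega>(1) show False by (simp add: ultrafilter_def trivial_limit_def)
qed

section \<open>Limits along ultrafilters\<close>

text \<open>
  If \<open>a\<close> is below the limit superior, then \<open>f x \<le> a\<close> does not hold eventually, so along an
  ultrafilter \<open>a < f x\<close> does.
\<close>

lemma tendsto_Limsup_ultrafilter:
  fixes f :: "'a \<Rightarrow> 'b :: {complete_linorder, linorder_topology}"
  assumes "ultrafilter \<omega>"
  shows "(f \<longlongrightarrow> Limsup \<omega> f) \<omega>"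
proof (rule order_tendstoI)
  fix a assume "a < Limsup \<omega> f"
  then have "\<not> eventually (\<lambda>x. \<not> a < f x) \<omega>"
    using Limsup_bounded[of f a \<omega>] by (auto simp: not_less)
  with assms show "eventually (\<lambda>x. a < f x) \<omega>"
    by (auto simp: ultrafilter_def)
next
  fix a assume "Limsup \<omega> f < a"
  then show "eventually (\<lambda>x. f x < a) \<omega>"
    by (rule Limsup_lessD)
qed

lemma enat_le_iff_less_Suc: "x \<le> enat n \<longleftrightarrow> x < enat (Suc n)"
  by (cases x) auto

lemma Lim_ultrafilter_le_enat_iff:
  fixes f :: "'a \<Rightarrow> enat"
  assumes "ultrafilter \<omega>"
  shows "Lim \<omega> f \<le> enat n \<longleftrightarrow> eventually (\<lambda>x. f x \<le> enat n) \<omega>"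
proof -
  have "Lim \<omega> f = Limsup \<omega> f"
    using assms by (intro tendsto_Lim tendsto_Limsup_ultrafilter) (auto simp: ultrafilter_def)
  moreover have "Limsup \<omega> f \<le> enat n \<longleftrightarrow> eventually (\<lambda>x. f x \<le> enat n) \<omega>"
  proof
    assume "Limsup \<omega> f \<le> enat n"
    then have "Limsup \<omega> f < enat (Suc n)"
      by (simp add: enat_le_iff_less_Suc)
    then have "eventually (\<lambda>x. f x < enat (Suc n)) \<omega>"
      by (rule Limsup_lessD)
    then show "eventually (\<lambda>x. f x \<le> enat n) \<omega>"
      by (simp add: enat_le_iff_less_Suc)
  qed (rule Limsup_bounded)
  ultimately show ?thesis by simp
qed

lemma Inf_enat_le_iff:
  assumes "\<And>m n. P m \<Longrightarrow> m \<le> n \<Longrightarrow> P n"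
  shows "Inf {enat n | n. P n} \<le> enat n \<longleftrightarrow> P n"
proof
  assume "Inf {enat n | n. P n} \<le> enat n"
  then obtain m where "P m" "m < Suc n"
    by (auto simp: enat_le_iff_less_Suc Inf_less_iff)
  with assms show "P n" by (simp add: less_Suc_eq_le)
qed (auto intro: Inf_lower)

section \<open>Dimension at a scale\<close>

context Metric_space
begin

lemma scale_dim_le_mono:
  assumes "scale_dim_le r D m" and "r' \<le> r" and "D \<le> D'" and "m \<le> n"
  shows "scale_dim_le r' D' n"
proof -
  obtain \<U> where \<U>: "\<And>i. i \<le> m \<Longrightarrow> \<U> i \<subseteq> Pow M"
      "\<And>i. i \<le> m \<Longrightarrow> disjoint_family_by r (\<U> i)"
      "\<And>i. i \<le> m \<Longrightarrow> uniformly_bounded_by D (\<U> i)"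
    and cover: "\<Union> (\<Union>i\<le>m. \<U> i) = M"
    using assms(1) by (auto simp: scale_dim_le_def)
  define \<V> where "\<V> i = (if i \<le> m then \<U> i else {})" for i
  have disj: "disjoint_family_by r' (\<V> i)" for i
    using \<U>(2)[of i] assms(2) le_less_trans[of "ereal r'" "ereal r"]
    by (simp add: \<V>_def disjoint_family_by_def)
  have bdd: "uniformly_bounded_by D' (\<V> i)" for i
    using \<U>(3)[of i] assms(3)
    by (auto simp: \<V>_def uniformly_bounded_by_def intro: order_trans[of _ "ereal D" "ereal D'"])
  have sub: "\<V> i \<subseteq> Pow M" for i
    using \<U>(1)[of i] by (simp add: \<V>_def)
  have "(\<Union>i\<le>n. \<V> i) = (\<Union>i\<le>m. \<U> i)"
    using assms(4) by (force simp: \<V>_def split: if_splits)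
  with cover have "\<Union> (\<Union>i\<le>n. \<V> i) = M" by simp
  with disj bdd sub show ?thesis
    unfolding scale_dim_le_def by (intro exI[of _ \<V>]) simp
qed

lemma linear_dim_le_iff:
  "linear_dim c k \<le> enat n \<longleftrightarrow> scale_dim_le (real k) (c * real k) n"
  unfolding linear_dim_def scale_dim_def
  by (rule Inf_enat_le_iff) (auto intro: scale_dim_le_mono)

lemma linear_dim_antimono:
  assumes "c \<le> c'"
  shows "linear_dim c' k \<le> linear_dim c k"
proof (cases "linear_dim c k")
  case (enat n)
  then have "scale_dim_le (real k) (c * real k) n"
    using linear_dim_le_iff[of c k n] by simp
  then have "scale_dim_le (real k) (c' * real k) n"
    by (rule scale_dim_le_mono) (use assms in \<open>auto intro: mult_right_mono\<close>)
  with enat show ?thesis by (simp add: linear_dim_le_iff)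
qed simp

text \<open>
  Real scales reduce to integral ones: a cover at scale \<open>\<lceil>r\<rceil>\<close> also serves at scale \<open>r\<close>, and
  \<open>\<lceil>r\<rceil> \<le> 2 * r\<close> as soon as \<open>r \<ge> 1\<close>.
\<close>

lemma AN_asdim_le_iff:
  "AN_asdim \<le> enat n \<longleftrightarrow> (\<exists>c>0. eventually (\<lambda>k. linear_dim c k \<le> enat n) sequentially)"
proof -
  have "AN_asdim \<le> enat n \<longleftrightarrow> AN_asdim_le n"
    unfolding AN_asdim_def
    by (rule Inf_enat_le_iff) (unfold AN_asdim_le_def, blast intro: scale_dim_le_mono)
  also have "\<dots> \<longleftrightarrow> (\<exists>c>0. eventually (\<lambda>k. linear_dim c k \<le> enat n) sequentially)"
  proof
    assume "AN_asdim_le n"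
    then obtain c r\<^sub>0 where c: "c > 0" "\<And>r. r > r\<^sub>0 \<Longrightarrow> scale_dim_le r (c * r) n"
      by (auto simp: AN_asdim_le_def)
    have "eventually (\<lambda>k. r\<^sub>0 < real k) sequentially"
      using filterlim_real_sequentially by (simp add: filterlim_at_top_dense)
    then have "eventually (\<lambda>k. linear_dim c k \<le> enat n) sequentially"
      by eventually_elim (simp add: linear_dim_le_iff c)
    with c(1) show "\<exists>c>0. eventually (\<lambda>k. linear_dim c k \<le> enat n) sequentially" by blast
  next
    assume "\<exists>c>0. eventually (\<lambda>k. linear_dim c k \<le> enat n) sequentially"
    then obtain c N where c: "c > 0"
      and N: "\<And>k. k \<ge> N \<Longrightarrow> scale_dim_le (real k) (c * real k) n"
      by (auto simp: eventually_sequentially linear_dim_le_iff)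
    have "scale_dim_le r ((2 * c) * r) n" if r: "r > max 1 (real N)" for r
    proof -
      define k where "k = nat \<lceil>r\<rceil>"
      have k: "r \<le> real k" "real k \<le> 2 * r"
        using r unfolding k_def by linarith+
      then have "scale_dim_le (real k) (c * real k) n"
        using r by (intro N) simp
      moreover have "c * real k \<le> (2 * c) * r"
        using mult_left_mono[OF k(2), of c] c by simp
      ultimately show ?thesis
        using k(1) by (auto intro: scale_dim_le_mono)
    qed
    then show "AN_asdim_le n"
      unfolding AN_asdim_le_def using c
      by (intro exI[of _ "2 * c"] conjI exI[of _ "max 1 (real N)"]) auto
  qed
  finally show ?thesis .
qed

lemma l_asdim_le_iff:
  assumes "ultrafilter \<omega>"
  shows "l_asdim \<omega> \<le> enat n \<longleftrightarrow> (\<exists>c>0. eventually (\<lambda>k. linear_dim c k \<le> enat n) \<omega>)"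
proof -
  have "l_asdim \<omega> \<le> enat n \<longleftrightarrow> (\<exists>c>0. Lim \<omega> (linear_dim c) \<le> enat n)"
    by (auto simp: l_asdim_def enat_le_iff_less_Suc INF_less_iff)
  then show ?thesis
    by (simp add: Lim_ultrafilter_le_enat_iff[OF assms])
qed

section \<open>The supremum formula\<close>

lemma AN_asdim_le_iff_l_asdim_le:
  "AN_asdim \<le> enat n \<longleftrightarrow> (\<forall>\<omega>\<in>nonprincipal_ultrafilters. l_asdim \<omega> \<le> enat n)"
proof
  assume "AN_asdim \<le> enat n"
  then obtain c where c: "c > 0" "eventually (\<lambda>k. linear_dim c k \<le> enat n) sequentially"
    by (auto simp: AN_asdim_le_iff)
  show "\<forall>\<omega>\<in>nonprincipal_ultrafilters. l_asdim \<omega> \<le> enat n"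
  proof
    fix \<omega> assume "\<omega> \<in> nonprincipal_ultrafilters"
    then have "ultrafilter \<omega>" "\<omega> \<le> sequentially"
      by (auto simp: nonprincipal_ultrafilters_iff)
    with c show "l_asdim \<omega> \<le> enat n"
      by (auto simp: l_asdim_le_iff intro: filter_leD)
  qed
next
  assume *: "\<forall>\<omega>\<in>nonprincipal_ultrafilters. l_asdim \<omega> \<le> enat n"
  \<comment> \<open>Integral constants suffice; the shift by one keeps them positive.\<close>
  define A where "A m = {k. linear_dim (real (Suc m)) k \<le> enat n}" for m
  have "\<exists>m. eventually (\<lambda>k. k \<in> A m) sequentially"
  proof (rule increasing_sets_eventually_sequentially)
    show "mono A"
      unfolding A_def
      by (intro monoI Collect_mono impI) (erule order_trans[rotated], simp add: linear_dim_antimono)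
  next
    fix \<omega> assume \<omega>: "\<omega> \<in> nonprincipal_ultrafilters"
    then have "ultrafilter \<omega>" by (simp add: nonprincipal_ultrafilters_iff)
    then obtain c where c: "eventually (\<lambda>k. linear_dim c k \<le> enat n) \<omega>"
      using * \<omega> l_asdim_le_iff by blast
    obtain m where "c \<le> real m"
      using real_arch_simple by blast
    then have "c \<le> real (Suc m)" by simp
    from c have "eventually (\<lambda>k. k \<in> A m) \<omega>"
      unfolding A_def mem_Collect_eq
      by (rule eventually_mono) (rule order_trans[OF linear_dim_antimono[OF \<open>c \<le> real (Suc m)\<close>]])
    then show "\<exists>m. eventually (\<lambda>k. k \<in> A m) \<omega>" ..
  qed
  then obtain m where "eventually (\<lambda>k. linear_dim (real (Suc m)) k \<le> enat n) sequentially"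
    by (auto simp: A_def)
  then show "AN_asdim \<le> enat n"
    unfolding AN_asdim_le_iff by (intro exI[of _ "real (Suc m)"]) simp
qed

end

theorem theorem3p1:
  fixes M :: "'a set" and d :: "'a \<Rightarrow> 'a \<Rightarrow> real"
  assumes "Metric_space M d"
  shows "Metric_space.AN_asdim M d =
    (SUP \<omega>\<in>nonprincipal_ultrafilters. Metric_space.l_asdim M d \<omega>)"
proof -
  interpret Metric_space M d by fact
  let ?S = "SUP \<omega>\<in>nonprincipal_ultrafilters. l_asdim \<omega>"
  have iff: "AN_asdim \<le> enat n \<longleftrightarrow> ?S \<le> enat n" for n
    by (simp add: AN_asdim_le_iff_l_asdim_le SUP_le_iff)
  show ?thesis
  proof (rule antisym)
    show "AN_asdim \<le> ?S" using iff by (cases ?S) auto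
    show "?S \<le> AN_asdim" using iff by (cases AN_asdim) auto
  qed
qed

end
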